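(* Let $p$ and $q$ be positive coprime integers with $p\geqslant 59\,q$, and let $$Q_{pq}(t)=t^{10}+(2q^2+p^2)(3q^2-2p^2)\,t^8+(q^8+10p^2q^6+4p^4q^4-14p^6q^2+p^8)\,t^6-p^2q^2(q^8-14p^2q^6+4p^4q^4+10p^6q^2+p^8)\,t^4-p^6q^6(q^2+2p^2)(3p^2-2q^2)\,t^2-q^{10}p^{10}.$$ Then the equation $Q_{pq}(t)=0$ has at least one real root $t$ satisfying $$p^2+2qp-2q^2<t<p^2+2qp-2q^2+\frac{9q^3}{p}.$$ *)

theory Defs
  imports Complex_Main
begin

definition Q :: "int \<Rightarrow> int \<Rightarrow> real \<Rightarrow> real" where
  "Q p q t =
     t^10
     + of_int ((2*q^2 + p^2) * (3*q^2 - 2*p^2)) * t^8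
     + of_int (q^8 + 10*p^2*q^6 + 4*p^4*q^4 - 14*p^6*q^2 + p^8) * t^6
     - of_int (p^2*q^2 * (q^8 - 14*p^2*q^6 + 4*p^4*q^4 + 10*p^6*q^2 + p^8)) * t^4
     - of_int (p^6*q^6 * (q^2 + 2*p^2) * (3*p^2 - 2*q^2)) * t^2
     - of_int (q^10 * p^10)"

end

theory Submission
  imports Defs
begin

text \<open>
  Everything is homogeneous: with \<open>x = p/q\<close> and \<open>t = q\<^sup>2 s\<close> the claim concerns a one-parameter
  family of polynomials in \<open>s\<close>, with the interval from \<open>x\<^sup>2 + 2x - 2\<close> to
  \<open>x\<^sup>2 + 2x - 2 + 9/x\<close>.  Expanded in powers of \<open>x - 1\<close>, the values at the two endpoints
  have no positive, respectively no negative, coefficients (the right one after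
  multiplication by \<open>x\<^sup>1\<^sup>0\<close>), so the intermediate value theorem applies.
\<close>

definition Qn :: "real \<Rightarrow> real \<Rightarrow> real" where
  "Qn x s =
     s^10
     + (2 + x^2) * (3 - 2*x^2) * s^8
     + (1 + 10*x^2 + 4*x^4 - 14*x^6 + x^8) * s^6
     - x^2 * (1 - 14*x^2 + 4*x^4 + 10*x^6 + x^8) * s^4
     - x^6 * (1 + 2*x^2) * (3*x^2 - 2) * s^2
     - x^10"

text \<open>Give \<open>p\<close> and \<open>q\<close> weight 1 and \<open>t\<close> weight 2: every
  term of \<open>Q\<close> then has weight 20, whence the factor \<open>q^20\<close>.\<close>

lemma Q_eq_Qn:
  assumes "q \<noteq> 0"
  shows "Q p q (of_int q^2 * s) = of_int q^20 * Qn (of_int p / of_int q) s"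
proof -
  define x :: real where "x = of_int p / of_int q"
  have p: "of_int p = x * of_int q"
    using assms by (simp add: x_def)
  show ?thesis
    unfolding x_def[symmetric]
    unfolding Q_def Qn_def of_int_add of_int_diff of_int_mult of_int_power
      of_int_numeral p
    by algebra
qed

text \<open>The endpoint starts the large-\<open>x\<close> expansion of a root: substituting it
  cancels the terms of degree 20 down to 17.\<close>

lemma Qn_lower_neg:
  assumes "x > 1"
  shows "Qn x (x^2 + 2*x - 2) < 0"
proof -
  define y where "y = x - 1"
  have "y > 0" and x: "x = y + 1"
    using assms by (simp_all add: y_def)
  \<comment> \<open>No constant term appears, since \<open>Qn 1 1 = 0\<close>; strictness comes from
    \<open>y > 0\<close>.\<close>
  have "Qn x (x^2 + 2*x - 2) =
         - (80 * y^16 + 2080 * y^15 + 23808 * y^14 + 157568 * y^13 + 666336 * y^12 +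
           1881120 * y^11 + 3609920 * y^10 + 4740864 * y^9 + 4291312 * y^8 + 2717120 *
           y^7 + 1215104 * y^6 + 382464 * y^5 + 82768 * y^4 + 11648 * y^3 + 944 * y^2 +
           32 * y)"
    unfolding Qn_def x by algebra
  also have "\<dots> < 0"
    unfolding neg_less_0_iff_less using \<open>y > 0\<close>
    by (intro add_pos_pos mult_pos_pos zero_less_power) auto
  finally show ?thesis .
qed

text \<open>Adding \<open>c/x\<close> to the lower endpoint changes the leading term
  \<open>-80 * x^16\<close> to \<open>(16*c - 80) * x^16\<close>. The root thus has \<open>c\<close>
  near 5 for large \<open>x\<close>, and \<open>c = 9\<close> overshoots it, leaving
  \<open>64 * x^16\<close>.\<close>

lemma Qn_upper_pos:
  assumes "x > 1"
  shows "Qn x (x^2 + 2*x - 2 + 9/x) > 0"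
proof -
  define y where "y = x - 1"
  have "y > 0" and x: "x = y + 1"
    using assms by (simp_all add: y_def)
  define s where "s = x^2 + 2*x - 2 + 9/x"
  \<comment> \<open>\<open>Qn x\<close> has degree 10 in \<open>s\<close>, so the factor
    \<open>x^10\<close> turns every \<open>s\<close> into the polynomial
    \<open>x * s\<close>.\<close>
  have xs: "x * s = x^3 + 2*x^2 - 2*x + 9"
    using assms by (simp add: s_def field_simps power3_eq_cube power2_eq_square)
  have "x^10 * Qn x s =
      (x*s)^10
      + (2 + x^2) * (3 - 2*x^2) * x^2 * (x*s)^8
      + (1 + 10*x^2 + 4*x^4 - 14*x^6 + x^8) * x^4 * (x*s)^6
      - x^2 * (1 - 14*x^2 + 4*x^4 + 10*x^6 + x^8) * x^6 * (x*s)^4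
      - x^6 * (1 + 2*x^2) * (3*x^2 - 2) * x^8 * (x*s)^2
      - x^20"
    unfolding Qn_def by algebra
  also have "\<dots> =
           64 * y^26 + 2880 * y^25 + 58964 * y^24 + 740344 * y^23 + 6488596 * y^22 +
           42861348 * y^21 + 224795584 * y^20 + 971170132 * y^19 + 3547509053 * y^18 +
           11163962638 * y^17 + 30686351732 * y^16 + 74415083874 * y^15 + 160366709196 *
           y^14 + 308686090018 * y^13 + 532439591573 * y^12 + 824312548554 * y^11 +
           1145584102151 * y^10 + 1427004818612 * y^9 + 1588352770509 * y^8 +
           1571116183916 * y^7 + 1370800466677 * y^6 + 1041831727706 * y^5 +
           679255152720 * y^4 + 368573770250 * y^3 + 160813001435 * y^2 + 50773233280 *
           y + 10301979699"
    unfolding xs unfolding x by algebra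
  also have "\<dots> > 0"
    using \<open>y > 0\<close> by (intro add_pos_pos mult_pos_pos zero_less_power) auto
  finally have "x^10 * Qn x s > 0" .
  then show ?thesis
    using assms by (simp add: zero_less_mult_iff s_def)
qed

theorem theorem4p3:
  fixes p q :: int
  assumes "p > 0" and "q > 0" and "coprime p q" and "p \<ge> 59 * q"
  shows "\<exists>t::real. Q p q t = 0
           \<and> of_int (p^2 + 2*q*p - 2*q^2) < t
           \<and> t < of_int (p^2 + 2*q*p - 2*q^2) + 9 * of_int q ^ 3 / of_int p"
proof -
  define x :: real where "x = of_int p / of_int q"
  have "p > q"
    using assms by linarith
  then have "x > 1"
    using assms by (simp add: x_def)
  have p: "of_int p = x * of_int q"
    using assms by (simp add: x_def)
  let ?a = "x^2 + 2*x - 2"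
  let ?b = "?a + 9/x"
  have neg: "Qn x ?a < 0" and pos: "Qn x ?b > 0"
    using Qn_lower_neg Qn_upper_pos \<open>x > 1\<close> by blast+
  have "continuous_on {?a..?b} (Qn x)"
    unfolding Qn_def by (intro continuous_intros)
  then obtain s where s: "?a \<le> s" "s \<le> ?b" "Qn x s = 0"
    using IVT'[of "Qn x" ?a 0 ?b] neg pos \<open>x > 1\<close> by auto
  then have "?a < s" "s < ?b"
    using neg pos by (auto simp: less_le)
  \<comment> \<open>Scaling by \<open>q^2 > 0\<close> preserves the strict bounds and turns
    \<open>9/x\<close> into \<open>9 * q^3 / p\<close>.\<close>
  moreover have "of_int (p^2 + 2*q*p - 2*q^2) = of_int q^2 * ?a"
    by (simp add: p algebra_simps power2_eq_square)
  moreover have "of_int (p^2 + 2*q*p - 2*q^2) + 9 * of_int q^3 / of_int p = of_int q^2 * ?b"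
    using assms \<open>x > 1\<close> by (simp add: p field_simps power2_eq_square power3_eq_cube)
  moreover have "Q p q (of_int q^2 * s) = 0"
    using Q_eq_Qn[of q p s] s assms by (simp add: x_def)
  ultimately show ?thesis
    using assms by (intro exI[of _ "of_int q^2 * s"]) simp
qed

end
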